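(* Let $d$ be a positive integer and let $G=(V,E)$ be a graph on at least $d+2$ vertices that is minimally globally rigid in $\mathbb{R}^d$. Then $|E| \leq (d+1)|V| - \binom{d+2}{2}$.
   Context: A framework in $\mathbb{R}^d$ is a pair $(G,p)$ with $G=(V,E)$ a finite simple graph and $p:V\to\mathbb{R}^d$. It is generic if the set of all coordinates of the points $p(v)$, $v\in V$, is algebraically independent over $\mathbb{Q}$. Two frameworks $(G,p),(G,q)$ are equivalent if $\|p(u)-p(v)\|=\|q(u)-q(v)\|$ for every edge $uv\in E$, and congruent if this holds for every pair of vertices $u,v\in V$. A framework $(G,p)$ in $\mathbb{R}^d$ is globally rigid if every equivalent framework in $\mathbb{R}^d$ is congruent to it. A graph $G$ is globally rigid in $\mathbb{R}^d$ if its generic realizations in $\mathbb{R}^d$ are globally rigid (this is known to depend only on $G$). $G$ is minimally globally rigid in $\mathbb{R}^d$ if it is globally rigid in $\mathbb{R}^d$ but $G-e$ is not globally rigid in $\mathbb{R}^d$ for every edge $e$. *)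

theory Defs
  imports "HOL-Analysis.Analysis" "HOL-Library.Poly_Mapping"
begin

(* A polynomial with rational coefficients in variables indexed by 'i is a finitely supported
   map from monomials to coefficients; a monomial is a finitely supported exponent vector. *)
type_synonym 'i rat_mpoly = "('i \<Rightarrow>\<^sub>0 nat) \<Rightarrow>\<^sub>0 rat"

definition mpoly_vars :: "'i rat_mpoly \<Rightarrow> 'i set" where
  "mpoly_vars P = (\<Union>m\<in>Poly_Mapping.keys P. Poly_Mapping.keys m)"

definition mpoly_eval :: "('i \<Rightarrow> real) \<Rightarrow> 'i rat_mpoly \<Rightarrow> real" where
  "mpoly_eval x P =
     (\<Sum>m\<in>Poly_Mapping.keys P. of_rat (Poly_Mapping.lookup P m) *
        (\<Prod>i\<in>Poly_Mapping.keys m. x i ^ Poly_Mapping.lookup m i))"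

(* Independence is that of the indexed family, so coincidences x i = x j with i \<noteq> j are
   excluded (take the polynomial X_i - X_j). *)
definition alg_independent_over_rat :: "'i set \<Rightarrow> ('i \<Rightarrow> real) \<Rightarrow> bool" where
  "alg_independent_over_rat I x \<longleftrightarrow>
     (\<forall>P :: 'i rat_mpoly. mpoly_vars P \<subseteq> I \<longrightarrow> mpoly_eval x P = 0 \<longrightarrow> P = 0)"

definition simple_graph :: "'v set \<Rightarrow> 'v set set \<Rightarrow> bool" where
  "simple_graph V E \<longleftrightarrow> finite V \<and> (\<forall>e\<in>E. e \<subseteq> V \<and> card e = 2)"

(* A realization is a total function on the vertex type; only its values on V matter. *)
definition generic_realization :: "'v set \<Rightarrow> ('v \<Rightarrow> real ^ 'd::finite) \<Rightarrow> bool" where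
  "generic_realization V p \<longleftrightarrow>
     alg_independent_over_rat (V \<times> (UNIV :: 'd::finite set)) (\<lambda>(v, i). p v $ i)"

definition equivalent_frameworks ::
  "'v set set \<Rightarrow> ('v \<Rightarrow> real ^ 'd::finite) \<Rightarrow> ('v \<Rightarrow> real ^ 'd::finite) \<Rightarrow> bool" where
  "equivalent_frameworks E p q \<longleftrightarrow>
     (\<forall>u v. {u, v} \<in> E \<longrightarrow> norm (p u - p v) = norm (q u - q v))"

definition congruent_frameworks ::
  "'v set \<Rightarrow> ('v \<Rightarrow> real ^ 'd::finite) \<Rightarrow> ('v \<Rightarrow> real ^ 'd::finite) \<Rightarrow> bool" where
  "congruent_frameworks V p q \<longleftrightarrow>
     (\<forall>u\<in>V. \<forall>v\<in>V. norm (p u - p v) = norm (q u - q v))"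

definition globally_rigid_framework ::
  "'v set \<Rightarrow> 'v set set \<Rightarrow> ('v \<Rightarrow> real ^ 'd::finite) \<Rightarrow> bool" where
  "globally_rigid_framework V E p \<longleftrightarrow>
     (\<forall>q :: 'v \<Rightarrow> real ^ 'd::finite. equivalent_frameworks E p q \<longrightarrow> congruent_frameworks V p q)"

(* The dimension of the ambient space is CARD('d), passed as a type argument. *)
definition globally_rigid :: "'d::finite itself \<Rightarrow> 'v set \<Rightarrow> 'v set set \<Rightarrow> bool" where
  "globally_rigid (_ :: 'd::finite itself) V E \<longleftrightarrow>
     (\<forall>p :: 'v \<Rightarrow> real ^ 'd::finite. generic_realization V p \<longrightarrow> globally_rigid_framework V E p)"

definition minimally_globally_rigid :: "'d::finite itself \<Rightarrow> 'v set \<Rightarrow> 'v set set \<Rightarrow> bool" where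
  "minimally_globally_rigid (T :: 'd::finite itself) V E \<longleftrightarrow>
     globally_rigid T V E \<and> (\<forall>e\<in>E. \<not> globally_rigid T V (E - {e}))"

end

theory Submission
  imports Defs "HOL-Computational_Algebra.Polynomial"
begin

text \<open>Suppose that \<open>E\<close> has more edges than the bound allows. Its rigidity rows are then dependent at
  every generic configuration in dimension \<open>d + 1\<close>, so some edge \<open>e\<close> lies in the support of a
  stress of \<open>(p, h)\<close> for every generic \<open>p\<close> in dimension \<open>d\<close> and suitable height functions \<open>h\<close>.
  We show that the length of \<open>e\<close> is then determined by the other edge lengths, contradicting
  minimality. Let \<open>p'\<close> be equivalent to the generic \<open>p\<close> on \<open>E - {e}\<close>. By genericity, \<open>p\<close> and \<open>p'\<close>
  have the same stresses on \<open>E - {e}\<close>. Comparing the stresses of \<open>(p, h)\<close> for different \<open>h\<close>, one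
  finds a single stress of both \<open>p\<close> and \<open>p'\<close> on \<open>E\<close> that is nonzero on \<open>e\<close>. A stress annihilates
  the vector of squared edge lengths, so the lengths of \<open>e\<close> agree. In particular, the
  characterization of global rigidity by stress matrices of maximal rank is not needed.\<close>

section \<open>Rational polynomial functions\<close>

text \<open>Rational polynomials are taken as functions so that membership follows from the
  introduction rules; \<open>rat_poly_fun_subset\<close> passes to the formal
  \<open>rat_mpoly\<close>.\<close>

inductive_set rat_poly_fun :: "'i set \<Rightarrow> (('i \<Rightarrow> real) \<Rightarrow> real) set" for J where
  const: "c \<in> \<rat> \<Longrightarrow> (\<lambda>x. c) \<in> rat_poly_fun J"
| var: "i \<in> J \<Longrightarrow> (\<lambda>x. x i) \<in> rat_poly_fun J"
| add: "f \<in> rat_poly_fun J \<Longrightarrow> g \<in> rat_poly_fun J \<Longrightarrow> (\<lambda>x. f x + g x) \<in> rat_poly_fun J"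
| mult: "f \<in> rat_poly_fun J \<Longrightarrow> g \<in> rat_poly_fun J \<Longrightarrow> (\<lambda>x. f x * g x) \<in> rat_poly_fun J"

lemma rat_poly_fun_diff:
  assumes "f \<in> rat_poly_fun J" "g \<in> rat_poly_fun J"
  shows "(\<lambda>x. f x - g x) \<in> rat_poly_fun J"
proof -
  have "(\<lambda>x. f x + (-1) * g x) \<in> rat_poly_fun J"
    using assms by (intro rat_poly_fun.intros) auto
  then show ?thesis by simp
qed

lemma rat_poly_fun_sum:
  assumes "finite A" "\<And>a. a \<in> A \<Longrightarrow> f a \<in> rat_poly_fun J"
  shows "(\<lambda>x. \<Sum>a\<in>A. f a x) \<in> rat_poly_fun J"
  using assms by (induction A) (auto intro: rat_poly_fun.intros)

section \<open>Evaluation of formal polynomials\<close>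

definition monomial_eval :: "('i \<Rightarrow> real) \<Rightarrow> ('i \<Rightarrow>\<^sub>0 nat) \<Rightarrow> real" where
  "monomial_eval x m = (\<Prod>i\<in>Poly_Mapping.keys m. x i ^ Poly_Mapping.lookup m i)"

lemma monomial_eval_superset:
  assumes "finite S" "Poly_Mapping.keys m \<subseteq> S"
  shows "monomial_eval x m = (\<Prod>i\<in>S. x i ^ Poly_Mapping.lookup m i)"
  unfolding monomial_eval_def
  by (rule prod.mono_neutral_left) (use assms in \<open>auto simp: in_keys_iff\<close>)

lemma monomial_eval_add: "monomial_eval x (m + k) = monomial_eval x m * monomial_eval x k"
proof -
  let ?S = "Poly_Mapping.keys m \<union> Poly_Mapping.keys k"
  have "monomial_eval x (m + k) = (\<Prod>i\<in>?S. x i ^ Poly_Mapping.lookup (m + k) i)"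
    by (rule monomial_eval_superset) (simp_all add: Poly_Mapping.keys_add)
  also have "\<dots> = (\<Prod>i\<in>?S. x i ^ Poly_Mapping.lookup m i) * (\<Prod>i\<in>?S. x i ^ Poly_Mapping.lookup k i)"
    by (simp add: lookup_add power_add prod.distrib)
  also have "\<dots> = monomial_eval x m * monomial_eval x k"
    by (subst (1 2) monomial_eval_superset[of ?S]) auto
  finally show ?thesis .
qed

lemma mpoly_eval_superset:
  assumes "finite S" "Poly_Mapping.keys P \<subseteq> S"
  shows "mpoly_eval x P = (\<Sum>m\<in>S. of_rat (Poly_Mapping.lookup P m) * monomial_eval x m)"
  unfolding mpoly_eval_def monomial_eval_def[symmetric]
  by (rule sum.mono_neutral_left) (use assms in \<open>auto simp: in_keys_iff\<close>)

lemma mpoly_eval_add: "mpoly_eval x (P + Q) = mpoly_eval x P + mpoly_eval x Q"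
proof -
  let ?S = "Poly_Mapping.keys P \<union> Poly_Mapping.keys Q"
  have "mpoly_eval x (P + Q)
      = (\<Sum>m\<in>?S. of_rat (Poly_Mapping.lookup (P + Q) m) * monomial_eval x m)"
    by (rule mpoly_eval_superset) (simp_all add: Poly_Mapping.keys_add)
  also have "\<dots> = mpoly_eval x P + mpoly_eval x Q"
    by (subst (1 2) mpoly_eval_superset[of ?S])
       (auto simp: lookup_add of_rat_add ring_distribs sum.distrib)
  finally show ?thesis .
qed

lemma mpoly_eval_single: "mpoly_eval x (Poly_Mapping.single m c) = of_rat c * monomial_eval x m"
  by (subst mpoly_eval_superset[of "{m}"]) auto

lemma mpoly_vars_add: "mpoly_vars (P + Q) \<subseteq> mpoly_vars P \<union> mpoly_vars Q"
  using Poly_Mapping.keys_add[of P Q] by (auto simp: mpoly_vars_def)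

definition mpoly_fun :: "'i set \<Rightarrow> (('i \<Rightarrow> real) \<Rightarrow> real) set" where
  "mpoly_fun J = {f. \<exists>P. mpoly_vars P \<subseteq> J \<and> f = (\<lambda>x. mpoly_eval x P)}"

lemma mpoly_fun_add:
  assumes "f \<in> mpoly_fun J" "g \<in> mpoly_fun J"
  shows "(\<lambda>x. f x + g x) \<in> mpoly_fun J"
proof -
  from assms obtain P Q where "mpoly_vars P \<subseteq> J" "mpoly_vars Q \<subseteq> J"
      and fg: "f = (\<lambda>x. mpoly_eval x P)" "g = (\<lambda>x. mpoly_eval x Q)"
    by (auto simp: mpoly_fun_def)
  then have "mpoly_vars (P + Q) \<subseteq> J" using mpoly_vars_add[of P Q] by blast
  then show ?thesis
    unfolding mpoly_fun_def fg by (auto simp: mpoly_eval_add intro!: exI[of _ "P + Q"])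
qed

lemma mpoly_fun_monomial:
  assumes "Poly_Mapping.keys m \<subseteq> J"
  shows "(\<lambda>x. of_rat c * monomial_eval x m) \<in> mpoly_fun J"
  unfolding mpoly_fun_def using assms
  by (auto simp: mpoly_eval_single mpoly_vars_def split: if_splits
      intro!: exI[of _ "Poly_Mapping.single m c"])

lemma mpoly_fun_sum:
  assumes "finite A" "\<And>a. a \<in> A \<Longrightarrow> f a \<in> mpoly_fun J"
  shows "(\<lambda>x. \<Sum>a\<in>A. f a x) \<in> mpoly_fun J"
  using assms
proof (induction A)
  case empty
  show ?case using mpoly_fun_monomial[of 0 J 0] by simp
qed (auto intro: mpoly_fun_add)

lemma mpoly_fun_mult:
  assumes "f \<in> mpoly_fun J" "g \<in> mpoly_fun J"
  shows "(\<lambda>x. f x * g x) \<in> mpoly_fun J"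
proof -
  from assms obtain P Q where vars: "mpoly_vars P \<subseteq> J" "mpoly_vars Q \<subseteq> J"
      and fg: "f = (\<lambda>x. mpoly_eval x P)" "g = (\<lambda>x. mpoly_eval x Q)"
    by (auto simp: mpoly_fun_def)
  \<comment> \<open>Expansion into pairs of monomials reduces products to sums, since monomials
    multiply by adding exponents.\<close>
  have "(\<lambda>x. f x * g x) = (\<lambda>x. \<Sum>m\<in>Poly_Mapping.keys P. \<Sum>k\<in>Poly_Mapping.keys Q.
      of_rat (Poly_Mapping.lookup P m * Poly_Mapping.lookup Q k) * monomial_eval x (m + k))"
    unfolding fg mpoly_eval_def sum_product
    by (simp add: monomial_eval_add of_rat_mult mult_ac flip: monomial_eval_def)
  also have "\<dots> \<in> mpoly_fun J"
  proof (intro mpoly_fun_sum mpoly_fun_monomial)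
    fix m k assume "m \<in> Poly_Mapping.keys P" "k \<in> Poly_Mapping.keys Q"
    then show "Poly_Mapping.keys (m + k) \<subseteq> J"
      using vars Poly_Mapping.keys_add[of m k] unfolding mpoly_vars_def by blast
  qed auto
  finally show ?thesis .
qed

lemma rat_poly_fun_subset: "rat_poly_fun J \<subseteq> mpoly_fun J"
proof
  fix f assume "f \<in> rat_poly_fun J"
  then show "f \<in> mpoly_fun J"
  proof induction
    case (const c)
    then obtain r where "c = of_rat r" by (auto elim: Rats_cases)
    then show ?case
      using mpoly_fun_monomial[of 0 J r] by (simp add: monomial_eval_def)
  next
    case (var i)
    then show ?case
      using mpoly_fun_monomial[of "Poly_Mapping.single i 1" J 1] by (simp add: monomial_eval_def)
  qed (auto intro: mpoly_fun_add mpoly_fun_mult)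
qed

text \<open>The polynomial behind \<open>f\<close> has the root \<open>x\<close>, so it is zero.
  Genericity mostly enters by contraposition: one point where \<open>f\<close> is nonzero makes
  \<open>f x\<close> nonzero.\<close>

lemma alg_independent_vanish:
  assumes "alg_independent_over_rat J x" "f \<in> rat_poly_fun J" "f x = 0"
  shows "f y = 0"
proof -
  obtain P where P: "mpoly_vars P \<subseteq> J" "f = (\<lambda>x. mpoly_eval x P)"
    using assms(2) rat_poly_fun_subset by (force simp: mpoly_fun_def)
  with assms have "P = 0" by (auto simp: alg_independent_over_rat_def)
  with P show ?thesis by (simp add: mpoly_eval_def)
qed

section \<open>Rational points off the zero set of a polynomial\<close>

lemma rat_poly_fun_continuous:
  "f \<in> rat_poly_fun J \<Longrightarrow> continuous_on UNIV (\<lambda>s. f (x(i := s)))"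
proof (induction rule: rat_poly_fun.induct)
  case (var j)
  then show ?case by (cases "j = i") (auto intro: continuous_intros)
qed (auto intro: continuous_intros)

text \<open>Along a coordinate line the nonvanishing set is open, and the rationals are dense. The
  new value must differ from \<open>x i\<close> because vertex heights are varied this way
  later.\<close>

lemma rat_poly_fun_rational_update:
  assumes "f \<in> rat_poly_fun J" "f x \<noteq> 0"
  shows "\<exists>s\<in>\<rat>. s \<noteq> x i \<and> f (x(i := s)) \<noteq> 0"
proof -
  let ?U = "{s. f (x(i := s)) \<noteq> 0}"
  have "open ?U"
    using open_Collect_neq[OF rat_poly_fun_continuous[OF assms(1)] continuous_on_const] .
  moreover have "x i \<in> ?U" using assms(2) by simp
  ultimately obtain e where e: "e > 0" "\<And>s. dist s (x i) < e \<Longrightarrow> s \<in> ?U"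
    unfolding open_dist by blast
  obtain s where "s \<in> \<rat>" "x i < s" "s < x i + e"
    using Rats_dense_in_real[of "x i" "x i + e"] e(1) by auto
  then show ?thesis using e(2)[of s] by (intro bexI[of _ s]) (auto simp: dist_real_def)
qed

lemma rat_poly_fun_rational_point:
  assumes "f \<in> rat_poly_fun J" "finite W" "f x \<noteq> 0"
  shows "\<exists>z. f z \<noteq> 0 \<and> (\<forall>i\<in>W. z i \<in> \<rat>)"
  using assms(2)
proof induction
  case empty
  then show ?case using assms(3) by blast
next
  case (insert i W)
  then obtain z where z: "f z \<noteq> 0" "\<forall>i\<in>W. z i \<in> \<rat>" by blast
  obtain s where "s \<in> \<rat>" "f (z(i := s)) \<noteq> 0"
    using rat_poly_fun_rational_update[OF assms(1) z(1)] by blast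
  moreover have "\<forall>j\<in>insert i W. (z(i := s)) j \<in> \<rat>" using z(2) \<open>s \<in> \<rat>\<close> by auto
  ultimately show ?case by blast
qed

section \<open>Extending derivations\<close>

text \<open>The domain is a subring: differences and \<open>1\<close> give \<open>0\<close>,
  negatives and sums. The values of \<open>D\<close> may lie outside \<open>K\<close>.\<close>

definition derivation_on :: "real set \<Rightarrow> (real \<Rightarrow> real) \<Rightarrow> bool" where
  "derivation_on K D \<longleftrightarrow> 1 \<in> K \<and> (\<forall>a\<in>K. \<forall>b\<in>K. a - b \<in> K \<and> a * b \<in> K
     \<and> D (a - b) = D a - D b \<and> D (a * b) = D a * b + a * D b)"

context
  fixes K D assumes der: "derivation_on K D"
begin

lemma der_diff: "a \<in> K \<Longrightarrow> b \<in> K \<Longrightarrow> a - b \<in> K" "a \<in> K \<Longrightarrow> b \<in> K \<Longrightarrow> D (a - b) = D a - D b"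
  and der_mult: "a \<in> K \<Longrightarrow> b \<in> K \<Longrightarrow> a * b \<in> K"
    "a \<in> K \<Longrightarrow> b \<in> K \<Longrightarrow> D (a * b) = D a * b + a * D b"
  and der_one: "1 \<in> K" "D 1 = 0"
  using der by (auto simp: derivation_on_def) (metis add_cancel_right_left mult.right_neutral mult_1)

lemma der_zero: "0 \<in> K" "D 0 = 0"
  using der_diff[of 1 1] der_one by auto

lemma der_add: assumes "a \<in> K" "b \<in> K" shows "a + b \<in> K" "D (a + b) = D a + D b"
  using der_diff[of a "0 - b"] der_diff[of 0 b] der_zero assms by auto

lemma der_sum:
  assumes "finite A" "\<And>a. a \<in> A \<Longrightarrow> f a \<in> K"
  shows "sum f A \<in> K \<and> D (sum f A) = (\<Sum>a\<in>A. D (f a))"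
  using assms by (induction A) (auto simp: der_zero der_add)

definition Kpoly :: "real poly set" where "Kpoly = {f. \<forall>n. coeff f n \<in> K}"

lemma Kpoly_diff: "f \<in> Kpoly \<Longrightarrow> g \<in> Kpoly \<Longrightarrow> f - g \<in> Kpoly"
  by (auto simp: Kpoly_def der_diff)

lemma Kpoly_mult: "f \<in> Kpoly \<Longrightarrow> g \<in> Kpoly \<Longrightarrow> f * g \<in> Kpoly"
  by (auto simp: Kpoly_def coeff_mult der_mult intro!: der_sum[THEN conjunct1])

lemma Kpoly_monom: "c \<in> K \<Longrightarrow> monom c n \<in> Kpoly"
  by (auto simp: Kpoly_def der_zero)

lemma map_poly_der_diff:
  "f \<in> Kpoly \<Longrightarrow> g \<in> Kpoly \<Longrightarrow> map_poly D (f - g) = map_poly D f - map_poly D g"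
  by (rule poly_eqI) (auto simp: coeff_map_poly der_zero der_diff Kpoly_def)

lemma map_poly_der_mult:
  assumes "f \<in> Kpoly" "g \<in> Kpoly"
  shows "map_poly D (f * g) = map_poly D f * g + f * map_poly D g"
proof (rule poly_eqI)
  fix n
  have "D (\<Sum>i\<le>n. coeff f i * coeff g (n - i)) = (\<Sum>i\<le>n. D (coeff f i * coeff g (n - i)))"
    by (rule der_sum[THEN conjunct2]) (use assms in \<open>auto simp: Kpoly_def der_mult\<close>)
  then show "coeff (map_poly D (f * g)) n = coeff (map_poly D f * g + f * map_poly D g) n"
    using assms by (simp add: coeff_map_poly der_zero coeff_mult der_mult Kpoly_def sum.distrib)
qed

text \<open>By the product rule, this is the value at \<open>poly f a\<close> forced on any
  extension of \<open>D\<close> that takes the value \<open>c\<close> at \<open>a\<close>.\<close>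

definition eval_der :: "real \<Rightarrow> real \<Rightarrow> real poly \<Rightarrow> real" where
  "eval_der a c f = poly (map_poly D f) a + c * poly (pderiv f) a"

lemma eval_der_diff:
  "f \<in> Kpoly \<Longrightarrow> g \<in> Kpoly \<Longrightarrow> eval_der a c (f - g) = eval_der a c f - eval_der a c g"
  by (simp add: eval_der_def map_poly_der_diff pderiv_diff algebra_simps)

lemma eval_der_mult:
  assumes "f \<in> Kpoly" "g \<in> Kpoly"
  shows "eval_der a c (f * g) = eval_der a c f * poly g a + poly f a * eval_der a c g"
  using assms by (simp add: eval_der_def map_poly_der_mult pderiv_mult algebra_simps)

text \<open>If \<open>a\<close> is algebraic over \<open>K\<close>, the value of the derivation at \<open>a\<close> is forced by a
  polynomial \<open>m\<close> of minimal degree that vanishes at \<open>a\<close>; pseudo-division by \<open>m\<close> then shows that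
  every relation is respected.\<close>
lemma eval_der_consistent:
  "\<exists>c. \<forall>f\<in>Kpoly. poly f a = 0 \<longrightarrow> eval_der a c f = 0"
proof (cases "\<exists>f\<in>Kpoly. f \<noteq> 0 \<and> poly f a = 0")
  case False
  \<comment> \<open>Here \<open>a\<close> is transcendental over \<open>K\<close>: only the zero
    polynomial vanishes there, so any \<open>c\<close> would do.\<close>
  then have "\<forall>f\<in>Kpoly. poly f a = 0 \<longrightarrow> eval_der a 0 f = 0" by (auto simp: eval_der_def)
  then show ?thesis by blast
next
  case True
  define Z where "Z f \<longleftrightarrow> f \<in> Kpoly \<and> f \<noteq> 0 \<and> poly f a = 0" for f
  obtain m where m: "Z m" and min: "\<And>f. Z f \<Longrightarrow> degree m \<le> degree f"
    using True exists_least_iff[of "\<lambda>n. \<exists>f. Z f \<and> degree f = n"]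
    by (metis Z_def not_less)
  have pos: "degree m > 0"
  proof (rule ccontr)
    assume "\<not> degree m > 0"
    then obtain b where "m = [:b:]" by (auto elim: degree_eq_zeroE)
    then show False using m by (simp add: Z_def)
  qed
  have pderiv_in: "pderiv m \<in> Kpoly"
  proof -
    have "of_nat n * x \<in> K" if "x \<in> K" for n x
      using that by (induction n) (auto simp: der_zero der_add algebra_simps)
    then show ?thesis using m by (auto simp: Kpoly_def Z_def coeff_pderiv simp del: of_nat_Suc)
  qed
  \<comment> \<open>In characteristic zero \<open>pderiv m\<close> is nonzero and of smaller degree,
    so a root at \<open>a\<close> would contradict minimality.\<close>
  have "poly (pderiv m) a \<noteq> 0"
  proof
    assume "poly (pderiv m) a = 0"
    moreover have "pderiv m \<noteq> 0" using pos by (simp add: pderiv_eq_0_iff)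
    ultimately have "degree m \<le> degree (pderiv m)" using pderiv_in min by (simp add: Z_def)
    then show False using pos by (simp add: degree_pderiv)
  qed
  define c where "c = - poly (map_poly D m) a / poly (pderiv m) a"
  have Em: "eval_der a c m = 0"
    using \<open>poly (pderiv m) a \<noteq> 0\<close> by (simp add: eval_der_def c_def)
  have "eval_der a c f = 0" if "f \<in> Kpoly" "poly f a = 0" for f
    using that
  proof (induction "degree f" arbitrary: f rule: less_induct)
    case less
    show ?case
    proof (cases "f = 0")
      case True
      then show ?thesis by (simp add: eval_der_def)
    next
      case False
      then have le: "degree m \<le> degree f" using less.prems min by (simp add: Z_def)
      \<comment> \<open>Scaling \<open>f\<close> by the leading coefficient of \<open>m\<close>
        makes the leading terms of \<open>l * f\<close> and \<open>r * m\<close> cancel without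
        division in \<open>K\<close>.\<close>
      define l where "l = monom (lead_coeff m) 0"
      define r where "r = monom (lead_coeff f) (degree f - degree m)"
      define g where "g = l * f - r * m"
      have in_K: "l \<in> Kpoly" "r \<in> Kpoly" "m \<in> Kpoly"
        using m less.prems by (auto simp: l_def r_def Z_def intro!: Kpoly_monom) (auto simp: Kpoly_def)
      have gK: "g \<in> Kpoly" using in_K less.prems by (simp add: g_def Kpoly_diff Kpoly_mult)
      have g0: "poly g a = 0" using less.prems m by (simp add: g_def Z_def)
      have lc: "lead_coeff m \<noteq> 0" "lead_coeff f \<noteq> 0" using m False by (auto simp: Z_def)
      have lf: "l * f = smult (lead_coeff m) f" by (simp add: l_def monom_0)
      have deg: "degree g < degree f"
      proof -
        have "degree (r * m) \<le> degree f"
          using degree_mult_le[of r m] degree_monom_le[of "lead_coeff f" "degree f - degree m"] le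
          unfolding r_def by linarith
        then have "degree g \<le> degree f"
          unfolding g_def lf by (intro degree_diff_le) auto
        moreover have "coeff g (degree f) = 0"
        proof -
          have "coeff (r * m) (degree f) = lead_coeff f * lead_coeff m"
            using le by (simp add: r_def coeff_monom_mult)
          then show ?thesis by (simp add: g_def lf)
        qed
        moreover have "degree f > 0" using pos le by simp
        ultimately show ?thesis
          by (metis degree_0 le_neq_implies_less leading_coeff_0_iff)
      qed
      have "eval_der a c g = 0" using less.hyps[OF deg gK g0] .
      \<comment> \<open>The term \<open>r * m\<close> contributes nothing, as
        \<open>poly m a\<close> and \<open>eval_der a c m\<close> are both zero.\<close>
      moreover have "eval_der a c g = poly l a * eval_der a c f"
        using in_K less.prems m
        by (simp add: g_def eval_der_diff eval_der_mult Kpoly_mult Em Z_def)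
      ultimately show ?thesis using lc by (simp add: l_def poly_monom)
    qed
  qed
  then show ?thesis by blast
qed

text \<open>The new domain consists of the values at \<open>a\<close> of polynomials over
  \<open>K\<close>. Two polynomials with equal value differ by one vanishing at \<open>a\<close>, so
  the choice of \<open>c\<close> makes \<open>eval_der\<close> depend on the value only.\<close>

lemma derivation_adjoin:
  "\<exists>K' D'. derivation_on K' D' \<and> K \<subseteq> K' \<and> a \<in> K' \<and> (\<forall>b\<in>K. D' b = D b)"
proof -
  obtain c where c: "\<And>f. f \<in> Kpoly \<Longrightarrow> poly f a = 0 \<Longrightarrow> eval_der a c f = 0"
    using eval_der_consistent by blast
  define K' where "K' = (\<lambda>f. poly f a) ` Kpoly"
  define D' where "D' b = eval_der a c (SOME f. f \<in> Kpoly \<and> poly f a = b)" for b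
  have D': "D' (poly f a) = eval_der a c f" if "f \<in> Kpoly" for f
  proof -
    let ?g = "SOME g. g \<in> Kpoly \<and> poly g a = poly f a"
    have g: "?g \<in> Kpoly \<and> poly ?g a = poly f a"
      by (rule someI[of _ f]) (simp add: that)
    then have "eval_der a c (?g - f) = 0" using that by (intro c) (auto simp: Kpoly_diff)
    then show ?thesis using g that by (simp add: D'_def eval_der_diff)
  qed
  have const: "[:b:] \<in> Kpoly" if "b \<in> K" for b
    using Kpoly_monom[OF that, of 0] by (simp add: monom_0)
  have "derivation_on K' D'"
    unfolding derivation_on_def
  proof (intro conjI ballI)
    show "1 \<in> K'" unfolding K'_def using const[OF der_one(1)] by (force intro!: image_eqI)
  next
    fix x y assume "x \<in> K'" "y \<in> K'"
    then obtain f g where fg: "f \<in> Kpoly" "g \<in> Kpoly" "x = poly f a" "y = poly g a"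
      by (auto simp: K'_def)
    have diff: "x - y = poly (f - g) a" and mult: "x * y = poly (f * g) a" by (auto simp: fg)
    show "x - y \<in> K'" "x * y \<in> K'"
      unfolding diff mult K'_def using fg by (blast intro: Kpoly_diff Kpoly_mult)+
    show "D' (x - y) = D' x - D' y"
      unfolding diff using fg D'[OF Kpoly_diff[OF fg(1,2)]] by (simp add: D' eval_der_diff)
    show "D' (x * y) = D' x * y + x * D' y"
      unfolding mult using fg D'[OF Kpoly_mult[OF fg(1,2)]] by (simp add: D' eval_der_mult)
  qed
  moreover have "K \<subseteq> K'" unfolding K'_def using const by (force intro!: image_eqI)
  moreover have "a \<in> K'"
    unfolding K'_def using Kpoly_monom[OF der_one(1), of 1]
    by (intro image_eqI[of _ _ "monom 1 1"]) (auto simp: poly_monom)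
  moreover have "D' b = D b" if "b \<in> K" for b
    using D'[OF const[OF that]] by (simp add: eval_der_def map_poly_pCons der_zero pderiv_pCons)
  ultimately show ?thesis by blast
qed

end

lemma derivation_adjoin_finite:
  assumes "finite S" "derivation_on K D"
  shows "\<exists>K' D'. derivation_on K' D' \<and> K \<subseteq> K' \<and> S \<subseteq> K' \<and> (\<forall>b\<in>K. D' b = D b)"
  using assms(1)
proof induction
  case empty
  then show ?case using assms(2) by blast
next
  case (insert a S)
  then obtain K1 D1 where 1: "derivation_on K1 D1" "K \<subseteq> K1" "S \<subseteq> K1" "\<forall>b\<in>K. D1 b = D b"
    by blast
  obtain K2 D2 where "derivation_on K2 D2" "K1 \<subseteq> K2" "a \<in> K2" "\<forall>b\<in>K1. D2 b = D1 b"
    using derivation_adjoin[OF 1(1)] by blast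
  with 1 show ?case by (intro exI[of _ K2] exI[of _ D2]) auto
qed

section \<open>Derivations with prescribed values at algebraically independent numbers\<close>

lemma rat_poly_fun_differentiable:
  "f \<in> rat_poly_fun J \<Longrightarrow> (\<lambda>t. f (\<lambda>j. x j + t * v j)) differentiable at (t::real)"
  by (induction rule: rat_poly_fun.induct) (auto intro!: derivative_intros)

text \<open>By algebraic independence a rational polynomial function is determined by its value at \<open>x\<close>,
  so differentiation at \<open>x\<close> in direction \<open>v\<close> is a well-defined derivation of
  \<open>\<rat>[x j | j \<in> J]\<close>.\<close>
lemma derivation_of_alg_independent:
  assumes ind: "alg_independent_over_rat J x"
  shows "\<exists>K D. derivation_on K D \<and> (\<forall>j\<in>J. x j \<in> K \<and> D (x j) = v j)"
proof -
  define K where "K = (\<lambda>f. f x) ` rat_poly_fun J"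
  define dd where "dd f = deriv (\<lambda>t. f (\<lambda>j. x j + t * v j)) 0" for f :: "('a \<Rightarrow> real) \<Rightarrow> real"
  define D where "D b = dd (SOME f. f \<in> rat_poly_fun J \<and> f x = b)" for b
  have D: "D (f x) = dd f" if "f \<in> rat_poly_fun J" for f
  proof -
    let ?g = "SOME g. g \<in> rat_poly_fun J \<and> g x = f x"
    have g: "?g \<in> rat_poly_fun J \<and> ?g x = f x" by (rule someI[of _ f]) (simp add: that)
    have "?g y - f y = 0" for y
      by (rule alg_independent_vanish[OF ind, of "\<lambda>x. ?g x - f x"])
        (use g that in \<open>auto intro: rat_poly_fun_diff\<close>)
    then have "?g = f" by auto
    then show ?thesis by (simp add: D_def)
  qed
  have fd: "(\<lambda>t. f (\<lambda>j. x j + t * v j)) field_differentiable at 0" if "f \<in> rat_poly_fun J" for f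
    using rat_poly_fun_differentiable[OF that, of x v 0]
    by (simp add: field_differentiable_def real_differentiable_def)
  have "derivation_on K D"
    unfolding derivation_on_def
  proof (intro conjI ballI)
    show "1 \<in> K" unfolding K_def using rat_poly_fun.const[of 1 J] by (force intro!: image_eqI)
  next
    fix a b assume "a \<in> K" "b \<in> K"
    then obtain f g where fg: "f \<in> rat_poly_fun J" "g \<in> rat_poly_fun J" "a = f x" "b = g x"
      by (auto simp: K_def)
    have dK: "(\<lambda>x. f x - g x) \<in> rat_poly_fun J" and mK: "(\<lambda>x. f x * g x) \<in> rat_poly_fun J"
      using fg by (auto intro: rat_poly_fun_diff rat_poly_fun.mult)
    show "a - b \<in> K" "a * b \<in> K" unfolding K_def fg using dK mK by (force intro!: image_eqI)+
    show "D (a - b) = D a - D b"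
      using D[OF dK] fg fd by (simp add: D dd_def)
    show "D (a * b) = D a * b + a * D b"
      using D[OF mK] fg fd by (simp add: D dd_def)
  qed
  moreover have "x j \<in> K \<and> D (x j) = v j" if "j \<in> J" for j
  proof -
    have *: "(\<lambda>x. x j) \<in> rat_poly_fun J" using that by (rule rat_poly_fun.var)
    have "((\<lambda>t. x j + t * v j) has_field_derivative v j) (at 0)"
      by (auto intro!: derivative_eq_intros)
    then show ?thesis using D[OF *] * by (auto simp: dd_def K_def DERIV_imp_deriv)
  qed
  ultimately show ?thesis by blast
qed

section \<open>Linear independence of rows\<close>

definition row_indep :: "'a set \<Rightarrow> 'i set \<Rightarrow> ('a \<Rightarrow> 'i \<Rightarrow> real) \<Rightarrow> bool" where
  "row_indep A I M \<longleftrightarrow>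
     (\<forall>c. (\<forall>i\<in>I. (\<Sum>a\<in>A. c a * M a i) = 0) \<longrightarrow> (\<forall>a\<in>A. c a = 0))"

lemma row_indepD:
  "row_indep A I M \<Longrightarrow> (\<And>i. i \<in> I \<Longrightarrow> (\<Sum>a\<in>A. c a * M a i) = 0) \<Longrightarrow> a \<in> A \<Longrightarrow> c a = 0"
  unfolding row_indep_def by blast

text \<open>A dependency of the enlarged family must involve \<open>a0\<close>, so it can be scaled
  to \<open>1\<close> there; the zeros outside let it be summed over larger index sets.\<close>

lemma row_indep_insert:
  assumes "finite A" "a0 \<notin> A" "row_indep A I M" "\<not> row_indep (insert a0 A) I M"
  obtains c where "c a0 = 1" "\<And>a. a \<notin> insert a0 A \<Longrightarrow> c a = 0"
    "\<And>i. i \<in> I \<Longrightarrow> (\<Sum>a\<in>insert a0 A. c a * M a i) = 0"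
proof -
  obtain c where c: "\<And>i. i \<in> I \<Longrightarrow> (\<Sum>a\<in>insert a0 A. c a * M a i) = 0"
      and nz: "\<exists>a\<in>insert a0 A. c a \<noteq> 0"
    using assms(4) unfolding row_indep_def by blast
  have "c a0 \<noteq> 0"
  proof
    assume "c a0 = 0"
    then have "\<And>i. i \<in> I \<Longrightarrow> (\<Sum>a\<in>A. c a * M a i) = 0" using c assms(1,2) by simp
    then have "\<forall>a\<in>A. c a = 0" using row_indepD[OF assms(3)] by blast
    then show False using nz \<open>c a0 = 0\<close> by blast
  qed
  let ?c = "\<lambda>a. if a \<in> insert a0 A then c a / c a0 else 0"
  have "(\<Sum>a\<in>insert a0 A. ?c a * M a i) = 0" if "i \<in> I" for i
  proof -
    have "(\<Sum>a\<in>insert a0 A. ?c a * M a i) = (\<Sum>a\<in>insert a0 A. c a * M a i) / c a0"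
      unfolding sum_divide_distrib by (rule sum.cong) auto
    then show ?thesis using c[OF that] by simp
  qed
  then show ?thesis using \<open>c a0 \<noteq> 0\<close> by (intro that[of ?c]) auto
qed

text \<open>A step of Gaussian elimination with pivot \<open>M a0 i0\<close>, cleared of
  denominators so that polynomial entries stay polynomial.\<close>

definition elim_row :: "'a \<Rightarrow> 'i \<Rightarrow> ('a \<Rightarrow> 'i \<Rightarrow> real) \<Rightarrow> 'a \<Rightarrow> 'i \<Rightarrow> real" where
  "elim_row a0 i0 M a i = M a0 i0 * M a i - M a i0 * M a0 i"

lemma elim_row_sum:
  assumes "finite A" "a0 \<notin> A"
  shows "(\<Sum>a\<in>A. c a * elim_row a0 i0 M a i)
    = (\<Sum>a\<in>insert a0 A. (if a = a0 then - (\<Sum>b\<in>A. c b * M b i0) else c a * M a0 i0) * M a i)"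
proof -
  have "(\<Sum>a\<in>A. (if a = a0 then - (\<Sum>b\<in>A. c b * M b i0) else c a * M a0 i0) * M a i)
      = (\<Sum>a\<in>A. c a * M a0 i0 * M a i)"
    using assms(2) by (intro sum.cong) auto
  then show ?thesis
    using assms by (simp add: elim_row_def algebra_simps sum_subtractf sum_distrib_left)
qed

text \<open>The row \<open>a0\<close> is nonzero and offers a pivot. A relation among the eliminated
  rows pulls back to the original ones with its coefficients multiplied by the pivot.\<close>

lemma row_indep_elim:
  assumes "finite A" "a0 \<notin> A" "row_indep (insert a0 A) I M"
  obtains i0 where "i0 \<in> I" "M a0 i0 \<noteq> 0" "row_indep A (I - {i0}) (elim_row a0 i0 M)"
proof -
  have "\<exists>i0\<in>I. M a0 i0 \<noteq> 0"
  proof (rule ccontr)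
    assume *: "\<not> ?thesis"
    have "(\<Sum>a\<in>insert a0 A. (if a = a0 then 1 else 0) * M a i) = 0" if "i \<in> I" for i
      using * assms that by (auto intro!: sum.neutral)
    from row_indepD[OF assms(3) this, of a0] show False by simp
  qed
  then obtain i0 where i0: "i0 \<in> I" "M a0 i0 \<noteq> 0" by blast
  have "row_indep A (I - {i0}) (elim_row a0 i0 M)"
    unfolding row_indep_def
  proof (intro allI impI ballI)
    fix c a
    assume c: "\<forall>i\<in>I - {i0}. (\<Sum>a\<in>A. c a * elim_row a0 i0 M a i) = 0" and a: "a \<in> A"
    \<comment> \<open>Elimination clears column \<open>i0\<close>, so the relation also holds
      there.\<close>
    have "(\<Sum>a\<in>A. c a * elim_row a0 i0 M a i) = 0" if "i \<in> I" for i
      using c that by (cases "i = i0") (auto simp: elim_row_def)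
    then have "(if a = a0 then - (\<Sum>b\<in>A. c b * M b i0) else c a * M a0 i0) = 0"
      using a row_indepD[OF assms(3), of "\<lambda>a. if a = a0 then - (\<Sum>b\<in>A. c b * M b i0) else c a * M a0 i0" a]
      by (simp add: elim_row_sum[OF assms(1,2)])
    then show "c a = 0" using i0(2) a assms(2) by (auto split: if_splits)
  qed
  with i0 show ?thesis using that by blast
qed

lemma row_indep_card:
  assumes "finite A" "finite I" "row_indep A I M"
  shows "card A \<le> card I"
  using assms
proof (induction A arbitrary: I M)
  case (insert a0 A)
  obtain i0 where i0: "i0 \<in> I" "row_indep A (I - {i0}) (elim_row a0 i0 M)"
    using row_indep_elim[OF insert.hyps insert.prems(2)] by metis
  have "card A \<le> card (I - {i0})" using insert.IH[OF _ i0(2)] insert.prems by simp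
  moreover have "card I > 0" using i0 insert.prems card_gt_0_iff by blast
  ultimately show ?case using i0 insert by simp
qed simp

text \<open>The product of the pivots met in the elimination at \<open>x\<close> serves as
  \<open>g\<close>, in place of a nonzero minor: where it is nonzero, the same elimination
  succeeds.\<close>

lemma row_indep_certificate:
  assumes "finite A" "row_indep A I (\<lambda>a i. M a i x)"
    "\<And>a i. a \<in> A \<Longrightarrow> i \<in> I \<Longrightarrow> M a i \<in> rat_poly_fun J"
  shows "\<exists>g\<in>rat_poly_fun J. g x \<noteq> 0 \<and> (\<forall>y. g y \<noteq> 0 \<longrightarrow> row_indep A I (\<lambda>a i. M a i y))"
  using assms
proof (induction A arbitrary: I M)
  case empty
  then show ?case by (intro bexI[of _ "\<lambda>x. 1"]) (auto simp: row_indep_def intro: rat_poly_fun.const)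
next
  case (insert a0 A)
  obtain i0 where i0: "i0 \<in> I" "M a0 i0 x \<noteq> 0"
      "row_indep A (I - {i0}) (elim_row a0 i0 (\<lambda>a i. M a i x))"
    using row_indep_elim[OF insert.hyps insert.prems(1)] by metis
  define M' where "M' a i = (\<lambda>x. M a0 i0 x * M a i x - M a i0 x * M a0 i x)" for a i
  have "M' a i \<in> rat_poly_fun J" if "a \<in> A" "i \<in> I - {i0}" for a i
    unfolding M'_def using that insert.prems(2) i0(1)
    by (intro rat_poly_fun_diff rat_poly_fun.mult) auto
  then obtain g where g: "g \<in> rat_poly_fun J" "g x \<noteq> 0"
      "\<And>y. g y \<noteq> 0 \<Longrightarrow> row_indep A (I - {i0}) (\<lambda>a i. M' a i y)"
    using insert.IH[of "I - {i0}" M'] i0(3) by (auto simp: M'_def elim_row_def[abs_def])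
  have "row_indep (insert a0 A) I (\<lambda>a i. M a i y)" if nz: "M a0 i0 y * g y \<noteq> 0" for y
    unfolding row_indep_def
  proof (intro allI impI ballI)
    fix c a
    assume c: "\<forall>i\<in>I. (\<Sum>a\<in>insert a0 A. c a * M a i y) = 0" and a: "a \<in> insert a0 A"
    have split: "(\<Sum>a\<in>A. c a * M a i y) = - (c a0 * M a0 i y)" if "i \<in> I" for i
      using c that insert.hyps by (simp add: add_eq_0_iff)
    have "(\<Sum>a\<in>A. c a * M' a i y) = 0" if "i \<in> I" for i
    proof -
      have "(\<Sum>a\<in>A. c a * M' a i y)
          = M a0 i0 y * (\<Sum>a\<in>A. c a * M a i y) - M a0 i y * (\<Sum>a\<in>A. c a * M a i0 y)"
        by (simp add: M'_def algebra_simps sum_subtractf sum_distrib_left)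
      also have "\<dots> = 0" by (simp add: split that i0(1))
      finally show ?thesis .
    qed
    then have A0: "\<forall>a\<in>A. c a = 0"
      using row_indepD[OF g(3)[of y]] nz by force
    moreover have "c a0 = 0" using split[OF i0(1)] A0 nz by simp
    ultimately show "c a = 0" using a by blast
  qed
  then show ?case
    using g i0 insert.prems(2)
    by (intro bexI[of _ "\<lambda>x. M a0 i0 x * g x"]) (auto intro: rat_poly_fun.mult)
qed

text \<open>A relation in the union splits into \<open>s + t = 0\<close> with \<open>s\<close>
  orthogonal to \<open>t\<close>, so \<open>s\<close> has square sum zero and both parts vanish. The
  union is thus independent in \<open>I\<close>.\<close>

lemma row_indep_orthogonal:
  assumes "finite A" "finite B" "finite I"
    and "\<And>a b. a \<in> A \<Longrightarrow> b \<in> B \<Longrightarrow> (\<Sum>i\<in>I. M a i * N b i) = 0"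
    and "row_indep A I M" "row_indep B I N"
  shows "card A + card B \<le> card I"
proof -
  have "row_indep (A <+> B) I (case_sum M N)"
    unfolding row_indep_def
  proof (intro allI impI ballI)
    fix c z
    assume c: "\<forall>i\<in>I. (\<Sum>z\<in>A <+> B. c z * case_sum M N z i) = 0" and z: "z \<in> A <+> B"
    define s where "s i = (\<Sum>a\<in>A. c (Inl a) * M a i)" for i
    define t where "t i = (\<Sum>b\<in>B. c (Inr b) * N b i)" for i
    have st: "s i + t i = 0" if "i \<in> I" for i
      using c that assms(1,2) by (simp add: sum.Plus s_def t_def)
    have "(\<Sum>i\<in>I. s i * t i)
        = (\<Sum>i\<in>I. \<Sum>a\<in>A. \<Sum>b\<in>B. c (Inl a) * c (Inr b) * (M a i * N b i))"
      by (simp add: s_def t_def sum_product mult_ac)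
    also have "\<dots> = (\<Sum>a\<in>A. \<Sum>i\<in>I. \<Sum>b\<in>B. c (Inl a) * c (Inr b) * (M a i * N b i))"
      by (rule sum.swap)
    also have "\<dots> = (\<Sum>a\<in>A. \<Sum>b\<in>B. \<Sum>i\<in>I. c (Inl a) * c (Inr b) * (M a i * N b i))"
      by (intro sum.cong refl sum.swap)
    also have "\<dots> = 0" using assms(4) by (simp flip: sum_distrib_left)
    finally have "(\<Sum>i\<in>I. s i * t i) = 0" .
    moreover have "(\<Sum>i\<in>I. s i * t i) = - (\<Sum>i\<in>I. (s i)\<^sup>2)"
      unfolding sum_negf[symmetric] using st
      by (intro sum.cong refl) (simp add: power2_eq_square add_eq_0_iff)
    ultimately have "(\<Sum>i\<in>I. (s i)\<^sup>2) = 0" by simp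
    then have s0: "s i = 0" if "i \<in> I" for i
      using that assms(3) by (subst (asm) sum_nonneg_eq_0_iff) auto
    then have t0: "t i = 0" if "i \<in> I" for i using st that by force
    show "c z = 0"
      using z row_indepD[OF assms(5), of "\<lambda>a. c (Inl a)"] row_indepD[OF assms(6), of "\<lambda>b. c (Inr b)"] s0 t0
      by (auto simp: s_def t_def)
  qed
  from row_indep_card[OF _ assms(3) this] show ?thesis using assms(1,2) by (simp add: card_Plus)
qed

section \<open>Rigidity rows and stresses\<close>

text \<open>One coordinate block of a row of the rigidity matrix. The summand \<open>y = x\<close>
  is zero, so for an edge the sum is the difference to the other end, with no orientation
  chosen.\<close>

definition edge_row :: "'v set \<Rightarrow> ('v \<Rightarrow> real) \<Rightarrow> 'v \<Rightarrow> real" where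
  "edge_row e f x = (if x \<in> e then \<Sum>y\<in>e. f x - f y else 0)"

text \<open>The bilinear form of the Laplacian of a single edge.\<close>

definition edge_form :: "'v set \<Rightarrow> 'v set \<Rightarrow> ('v \<Rightarrow> real) \<Rightarrow> ('v \<Rightarrow> real) \<Rightarrow> real" where
  "edge_form V e f g = (\<Sum>x\<in>V. edge_row e f x * g x)"

lemma edge_form_pair:
  assumes "finite V" "{u, v} \<subseteq> V" "u \<noteq> v"
  shows "edge_form V {u, v} f g = (f u - f v) * (g u - g v)"
proof -
  have "edge_form V {u, v} f g = (\<Sum>x\<in>{u, v}. edge_row {u, v} f x * g x)"
    unfolding edge_form_def
    by (rule sum.mono_neutral_right) (use assms in \<open>auto simp: edge_row_def\<close>)
  then show ?thesis using assms(3) by (simp add: edge_row_def algebra_simps)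
qed

lemma simple_graph_edge:
  assumes "simple_graph V E" "e \<in> E"
  obtains u v where "e = {u, v}" "u \<noteq> v" "{u, v} \<subseteq> V"
  using assms unfolding simple_graph_def by (metis card_2_iff)

lemma edge_form_commute:
  assumes "simple_graph V E" "e \<in> E"
  shows "edge_form V e f g = edge_form V e g f"
proof -
  obtain u v where "e = {u, v}" "u \<noteq> v" "{u, v} \<subseteq> V" using assms by (elim simple_graph_edge)
  then show ?thesis using assms edge_form_pair[of V u v] by (simp add: simple_graph_def)
qed

definition rigidity_row :: "('v \<times> 'k \<Rightarrow> real) \<Rightarrow> 'v set \<Rightarrow> 'v \<times> 'k \<Rightarrow> real" where
  "rigidity_row q e = (\<lambda>(x, k). edge_row e (\<lambda>y. q (y, k)) x)"

text \<open>The stress matrix of \<open>w\<close> kills \<open>f\<close>. Treating one coordinate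
  function at a time lets a height function be handled like a coordinate.\<close>

definition is_stress :: "'v set \<Rightarrow> 'v set set \<Rightarrow> ('v set \<Rightarrow> real) \<Rightarrow> ('v \<Rightarrow> real) \<Rightarrow> bool" where
  "is_stress V E w f \<longleftrightarrow> (\<forall>x\<in>V. (\<Sum>e\<in>E. w e * edge_row e f x) = 0)"

lemma rigidity_row_rat_poly_fun:
  assumes "e \<subseteq> V" "finite e" "i \<in> V \<times> UNIV"
  shows "(\<lambda>q. rigidity_row q e i) \<in> rat_poly_fun (V \<times> UNIV)"
proof -
  obtain x k where i: "i = (x, k)" by (cases i)
  have "(\<lambda>q. \<Sum>y\<in>e. q (x, k) - q (y, k)) \<in> rat_poly_fun (V \<times> UNIV)"
    using assms i by (intro rat_poly_fun_sum rat_poly_fun_diff rat_poly_fun.var) auto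
  then show ?thesis
    by (cases "x \<in> e") (auto simp: i rigidity_row_def edge_row_def intro: rat_poly_fun.const)
qed

lemma is_stress_form:
  assumes "is_stress V E w f"
  shows "(\<Sum>e\<in>E. w e * edge_form V e f g) = 0"
proof -
  have "(\<Sum>e\<in>E. w e * edge_form V e f g) = (\<Sum>x\<in>V. (\<Sum>e\<in>E. w e * edge_row e f x) * g x)"
    unfolding edge_form_def sum_distrib_left sum_distrib_right
    by (subst sum.swap) (simp add: mult_ac)
  then show ?thesis using assms by (simp add: is_stress_def)
qed

lemma is_stressI:
  assumes "finite V" "\<And>g. (\<Sum>e\<in>E. w e * edge_form V e f g) = 0"
  shows "is_stress V E w f"
  unfolding is_stress_def
proof
  fix x assume "x \<in> V"
  have "edge_form V e f (\<lambda>y. if y = x then 1 else 0) = edge_row e f x" for e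
    using assms(1) \<open>x \<in> V\<close> by (simp add: edge_form_def if_distrib[of "\<lambda>t. _ * t"] cong: if_cong)
  then show "(\<Sum>e\<in>E. w e * edge_row e f x) = 0"
    using assms(2)[of "\<lambda>y. if y = x then 1 else 0"] by simp
qed

lemma is_stress_diff:
  "is_stress V E w f \<Longrightarrow> is_stress V E w' f \<Longrightarrow> is_stress V E (\<lambda>e. w e - w' e) f"
  by (simp add: is_stress_def left_diff_distrib sum_subtractf)

lemma is_stress_sum:
  "(\<And>a. a \<in> A \<Longrightarrow> is_stress V E (w a) f) \<Longrightarrow> is_stress V E (\<lambda>e. \<Sum>a\<in>A. b a * w a e) f"
  unfolding is_stress_def sum_distrib_right
  by (subst sum.swap) (simp add: mult.assoc flip: sum_distrib_left)

lemma is_stress_restrict: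
  assumes "finite E" "F \<subseteq> E" "\<And>e. e \<in> E - F \<Longrightarrow> w e = 0"
  shows "is_stress V E w f \<longleftrightarrow> is_stress V F w f"
proof -
  have "(\<Sum>e\<in>E. w e * edge_row e f x) = (\<Sum>e\<in>F. w e * edge_row e f x)" for x
    by (rule sum.mono_neutral_right) (use assms in auto)
  then show ?thesis by (simp add: is_stress_def)
qed

lemma sum_rigidity_row_eq_0_iff:
  "(\<forall>i\<in>V \<times> UNIV. (\<Sum>e\<in>F. w e * rigidity_row q e i) = 0)
    \<longleftrightarrow> (\<forall>k. is_stress V F w (\<lambda>x. q (x, k)))"
  by (auto simp: is_stress_def rigidity_row_def)

lemma stress_of_dependent_edge:
  assumes "finite E" "insert e F \<subseteq> E" "e \<notin> F"
    and "row_indep F (V \<times> UNIV) (rigidity_row q)"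
    and "\<not> row_indep (insert e F) (V \<times> UNIV) (rigidity_row q)"
  obtains w where "w e = 1" "\<And>f. f \<notin> insert e F \<Longrightarrow> w f = 0"
    "\<And>k. is_stress V E w (\<lambda>x. q (x, k))"
proof -
  have "finite F" using assms(1,2) finite_subset[of F E] by simp
  then obtain w where w: "w e = 1" "\<And>f. f \<notin> insert e F \<Longrightarrow> w f = 0"
      "\<forall>i\<in>V \<times> UNIV. (\<Sum>f\<in>insert e F. w f * rigidity_row q f i) = 0"
    by (rule row_indep_insert[OF _ assms(3-5)]) blast
  have "is_stress V E w (\<lambda>x. q (x, k))" for k
    using w(3) unfolding sum_rigidity_row_eq_0_iff
    using is_stress_restrict[OF assms(1,2), of w] w(2) by auto
  with w(1,2) show ?thesis using that by blast
qed

section \<open>Equivalent frameworks have the same stresses\<close>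

context
  fixes V :: "'v set" and H :: "'v set set" and p p' :: "'v \<times> 'd::finite \<Rightarrow> real"
  assumes graph: "simple_graph V H"
    and generic: "alg_independent_over_rat (V \<times> UNIV) p"
    and equiv: "\<And>u v. {u, v} \<in> H \<Longrightarrow>
      (\<Sum>k\<in>UNIV. (p (u, k) - p (v, k))\<^sup>2) = (\<Sum>k\<in>UNIV. (p' (u, k) - p' (v, k))\<^sup>2)"
begin

lemma finV: "finite V" and finH: "finite H"
  using graph unfolding simple_graph_def
  by (auto intro: finite_subset[of H "Pow V"])

text \<open>Applying to the length equations a derivation that takes prescribed values on the
  algebraically independent coordinates of \<open>p\<close> turns each velocity of \<open>p\<close> into
  a velocity of \<open>p'\<close> with the same effect on the edge lengths.\<close>
lemma velocity_transfer:
  "\<exists>v'. \<forall>e\<in>H. (\<Sum>k\<in>UNIV. edge_form V e (\<lambda>x. p (x, k)) (\<lambda>x. v (x, k)))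
    = (\<Sum>k\<in>UNIV. edge_form V e (\<lambda>x. p' (x, k)) (\<lambda>x. v' (x, k)))"
proof -
  obtain K0 D0 where 0: "derivation_on K0 D0" "\<forall>j\<in>V \<times> UNIV. p j \<in> K0 \<and> D0 (p j) = v j"
    using derivation_of_alg_independent[OF generic] by blast
  \<comment> \<open>Coordinates of \<open>p'\<close> may be algebraic or transcendental over those
    of \<open>p\<close>; the derivation extends to them in both cases.\<close>
  have "finite (p' ` (V \<times> UNIV))" using finV by simp
  from derivation_adjoin_finite[OF this 0(1)] obtain K D
    where der: "derivation_on K D" and KD: "K0 \<subseteq> K" "p' ` (V \<times> UNIV) \<subseteq> K" "\<forall>b\<in>K0. D b = D0 b"
    by blast
  have p: "p (x, k) \<in> K" "D (p (x, k)) = v (x, k)" "p' (x, k) \<in> K" if "x \<in> V" for x k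
    using that 0 KD by auto
  have square: "D (\<Sum>k\<in>UNIV. (q (a, k) - q (b, k))\<^sup>2)
      = 2 * (\<Sum>k\<in>UNIV. edge_form V {a, b} (\<lambda>x. q (x, k)) (\<lambda>x. D (q (x, k))))"
    if "a \<noteq> b" "{a, b} \<subseteq> V" "\<And>x k. x \<in> V \<Longrightarrow> q (x, k) \<in> K" for q :: "'v \<times> 'd \<Rightarrow> real" and a b
  proof -
    have "D (\<Sum>k\<in>UNIV. (q (a, k) - q (b, k))\<^sup>2) = (\<Sum>k\<in>UNIV. D ((q (a, k) - q (b, k))\<^sup>2))"
      using that by (intro der_sum[OF der, THEN conjunct2])
        (auto simp: power2_eq_square intro!: der_diff(1)[OF der] der_mult(1)[OF der])
    also have "\<dots> = (\<Sum>k\<in>UNIV. 2 * edge_form V {a, b} (\<lambda>x. q (x, k)) (\<lambda>x. D (q (x, k))))"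
      using that by (intro sum.cong refl)
        (simp add: power2_eq_square der_diff[OF der] der_mult[OF der] edge_form_pair[OF finV])
    finally show ?thesis by (simp add: sum_distrib_left)
  qed
  show ?thesis
  \<comment> \<open>The new velocity is \<open>D\<close> applied to the coordinates of
    \<open>p'\<close>; by \<open>square\<close>, the length equations differentiate to the
    claim.\<close>
  proof (intro exI ballI)
    fix e assume e: "e \<in> H"
    then obtain a b where ab: "e = {a, b}" "a \<noteq> b" "{a, b} \<subseteq> V"
      using graph by (elim simple_graph_edge)
    have "edge_form V e (\<lambda>x. p (x, k)) (\<lambda>x. D (p (x, k)))
        = edge_form V e (\<lambda>x. p (x, k)) (\<lambda>x. v (x, k))" for k
      unfolding edge_form_def by (intro sum.cong refl) (simp add: p)
    moreover have "(\<Sum>k\<in>UNIV. edge_form V e (\<lambda>x. p (x, k)) (\<lambda>x. D (p (x, k))))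
        = (\<Sum>k\<in>UNIV. edge_form V e (\<lambda>x. p' (x, k)) (\<lambda>x. D (p' (x, k))))"
      using square[OF ab(2,3), of p] square[OF ab(2,3), of p'] p equiv[of a b] e ab(1) by simp
    ultimately show "(\<Sum>k\<in>UNIV. edge_form V e (\<lambda>x. p (x, k)) (\<lambda>x. v (x, k)))
        = (\<Sum>k\<in>UNIV. edge_form V e (\<lambda>x. p' (x, k)) (\<lambda>x. (\<lambda>j. D (p' j)) (x, k)))"
      by simp
  qed
qed

text \<open>Testing equilibrium of \<open>p\<close> in axis \<open>k\<close> against
  \<open>g\<close> amounts to a velocity along that axis. Its transfer to \<open>p'\<close> has the
  same effect on lengths, which \<open>w\<close> annihilates.\<close>

lemma stress_transfer_back:
  assumes w: "\<And>k. is_stress V H w (\<lambda>x. p' (x, k))"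
  shows "is_stress V H w (\<lambda>x. p (x, k))"
proof (rule is_stressI[OF finV])
  fix g
  define v :: "'v \<times> 'd \<Rightarrow> real" where "v = (\<lambda>(x, j). if j = k then g x else 0)"
  obtain v' where v': "\<And>e. e \<in> H \<Longrightarrow>
      (\<Sum>k\<in>UNIV. edge_form V e (\<lambda>x. p (x, k)) (\<lambda>x. v (x, k)))
      = (\<Sum>k\<in>UNIV. edge_form V e (\<lambda>x. p' (x, k)) (\<lambda>x. v' (x, k)))"
    using velocity_transfer[of v] by blast
  have "edge_form V e (\<lambda>x. p (x, j)) (\<lambda>x. v (x, j))
      = (if j = k then edge_form V e (\<lambda>x. p (x, k)) g else 0)" for e j
    by (simp add: v_def edge_form_def)
  then have "(\<Sum>e\<in>H. w e * edge_form V e (\<lambda>x. p (x, k)) g)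
      = (\<Sum>e\<in>H. w e * (\<Sum>k\<in>UNIV. edge_form V e (\<lambda>x. p' (x, k)) (\<lambda>x. v' (x, k))))"
    by (intro sum.cong refl) (simp flip: v')
  also have "\<dots> = (\<Sum>k\<in>UNIV. \<Sum>e\<in>H. w e * edge_form V e (\<lambda>x. p' (x, k)) (\<lambda>x. v' (x, k)))"
    unfolding sum_distrib_left by (rule sum.swap)
  also have "\<dots> = 0" using is_stress_form[OF w] by simp
  finally show "(\<Sum>e\<in>H. w e * edge_form V e (\<lambda>x. p (x, k)) g) = 0" .
qed

text \<open>The reverse inclusion is a matter of rank, which is maximal at the generic \<open>p\<close>.\<close>
lemma stress_transfer:
  assumes w: "\<And>k. is_stress V H w (\<lambda>x. p (x, k))"
  shows "is_stress V H w (\<lambda>x. p' (x, k))"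
proof -
  define ind where "ind q F \<longleftrightarrow> F \<subseteq> H \<and> row_indep F (V \<times> UNIV) (rigidity_row q)"
    for q :: "'v \<times> 'd \<Rightarrow> real" and F
  have "ind p' {}" by (simp add: ind_def row_indep_def)
  moreover have "card F < Suc (card H)" if "ind p' F" for F
    using that card_mono[OF finH] by (auto simp: ind_def less_Suc_eq_le)
  \<comment> \<open>\<open>F\<close> indexes a basis of the row space at \<open>p'\<close>.\<close>
  ultimately obtain F where F: "ind p' F" and max: "\<And>F'. ind p' F' \<Longrightarrow> card F' \<le> card F"
    using ex_has_greatest_nat[of "ind p'" "{}" card "Suc (card H)"] by (metis le_imp_less_Suc less_Suc_eq_le)
  have FH: "F \<subseteq> H" and finF: "finite F" using F finH finite_subset by (auto simp: ind_def)
  have poly: "(\<lambda>q. rigidity_row q a i) \<in> rat_poly_fun (V \<times> UNIV)"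
    if "a \<in> F" "i \<in> V \<times> UNIV" for a and i :: "'v \<times> 'd"
    using that FH graph finite_subset[OF _ finV]
    by (intro rigidity_row_rat_poly_fun) (auto simp: simple_graph_def)
  obtain g where g: "g \<in> rat_poly_fun (V \<times> UNIV)" "g p' \<noteq> 0"
      "\<And>q. g q \<noteq> 0 \<Longrightarrow> row_indep F (V \<times> UNIV) (rigidity_row q)"
    using row_indep_certificate[of F "V \<times> UNIV" "\<lambda>a i q. rigidity_row q a i" p', OF finF _ poly] F
    by (auto simp: ind_def)
  have "g p \<noteq> 0" using alg_independent_vanish[OF generic g(1)] g(2) by blast
  then have ind_p: "row_indep F (V \<times> UNIV) (rigidity_row p)" by (rule g(3))
  \<comment> \<open>Each edge outside the basis yields a stress of \<open>p'\<close> that is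
    \<open>1\<close> on it and \<open>0\<close> on the other edges of \<open>H - F\<close>.\<close>
  have "\<exists>c. c e = 1 \<and> (\<forall>f. f \<notin> insert e F \<longrightarrow> c f = 0) \<and> (\<forall>k. is_stress V H c (\<lambda>x. p' (x, k)))"
    if "e \<in> H - F" for e
  proof -
    have "\<not> ind p' (insert e F)" using max[of "insert e F"] that finF by auto
    then show ?thesis
      using stress_of_dependent_edge[OF finH, of e F V p'] that F by (auto simp: ind_def) metis
  qed
  then obtain c where c: "\<And>e. e \<in> H - F \<Longrightarrow> c e e = 1"
      "\<And>e f. e \<in> H - F \<Longrightarrow> f \<notin> insert e F \<Longrightarrow> c e f = 0"
      "\<And>e k. e \<in> H - F \<Longrightarrow> is_stress V H (c e) (\<lambda>x. p' (x, k))"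
    by metis
  define s where "s f = (\<Sum>e\<in>H - F. w e * c e f)" for f
  have s: "is_stress V H s (\<lambda>x. p' (x, k))" for k
    unfolding s_def by (intro is_stress_sum c)
  have off: "w f - s f = 0" if "f \<in> H - F" for f
  proof -
    have "s f = (\<Sum>e\<in>H - F. if e = f then w f else 0)"
      unfolding s_def by (intro sum.cong refl) (use c that in auto)
    then show ?thesis using that finH by simp
  qed
  \<comment> \<open>The stress \<open>s\<close> of \<open>p'\<close> agrees with \<open>w\<close>
    off \<open>F\<close>. Pulled back to \<open>p\<close>, the difference lives on the independent
    rows of \<open>F\<close>, so it is zero.\<close>
  have "is_stress V H (\<lambda>f. w f - s f) (\<lambda>x. p (x, k))" for k
    by (intro is_stress_diff w stress_transfer_back s)
  then have "\<forall>k. is_stress V F (\<lambda>f. w f - s f) (\<lambda>x. p (x, k))"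
    using is_stress_restrict[OF finH FH, of "\<lambda>f. w f - s f"] off by blast
  then have "w f - s f = 0" if "f \<in> F" for f
    using that row_indepD[OF ind_p, of "\<lambda>f. w f - s f"]
    unfolding sum_rigidity_row_eq_0_iff[symmetric] by blast
  with off have "w f = s f" if "f \<in> H" for f using that by force
  then show ?thesis using s[of k] by (simp add: is_stress_def cong: sum.cong)
qed

end

section \<open>Infinitesimal motions of Euclidean space\<close>

text \<open>The pair \<open>(i, i)\<close> stands for the translation along axis \<open>i\<close> and \<open>(i, j)\<close> for the infinitesimal
  rotation in the plane of the axes \<open>i\<close> and \<open>j\<close>; the numbering \<open>r\<close> of the axes below selects one of
  \<open>(i, j)\<close> and \<open>(j, i)\<close>.\<close>
definition motion_row :: "('v \<times> 'k \<Rightarrow> real) \<Rightarrow> 'k \<times> 'k \<Rightarrow> 'v \<times> 'k \<Rightarrow> real" where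
  "motion_row q = (\<lambda>(i, j) (x, k).
     if i = j then (if k = i then 1 else 0)
     else if k = i then q (x, j) else if k = j then - q (x, i) else 0)"

lemma motion_row_rat_poly_fun:
  assumes "x \<in> V \<times> UNIV"
  shows "(\<lambda>q. motion_row q ij x) \<in> rat_poly_fun (V \<times> UNIV)"
proof -
  have "(\<lambda>q. - q (y, k)) \<in> rat_poly_fun (V \<times> UNIV)" if "y \<in> V" for y and k :: 'b
  proof -
    have "(\<lambda>q. (-1) * q (y, k)) \<in> rat_poly_fun (V \<times> UNIV)"
      using that by (intro rat_poly_fun.intros) auto
    then show ?thesis by simp
  qed
  moreover obtain y k where "x = (y, k)" by (cases x)
  moreover obtain i j where "ij = (i, j)" by (cases ij)
  ultimately show ?thesis
    using assms
    by (cases "i = j"; cases "k = i"; cases "k = j")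
      (auto simp: motion_row_def intro: rat_poly_fun.const rat_poly_fun.var)
qed

text \<open>Infinitesimal isometries preserve lengths to first order: translations have zero
  velocity differences, and for rotations the contributions of the two axes cancel.\<close>

lemma rigidity_row_motion_row_orthogonal:
  fixes q :: "'v \<times> 'k::finite \<Rightarrow> real"
  assumes "simple_graph V E" "e \<in> E"
  shows "(\<Sum>x\<in>V \<times> UNIV. rigidity_row q e x * motion_row q (i, j) x) = 0"
proof -
  let ?B = "\<lambda>k. edge_form V e (\<lambda>x. q (x, k)) (\<lambda>x. motion_row q (i, j) (x, k))"
  have "(\<Sum>x\<in>V \<times> UNIV. rigidity_row q e x * motion_row q (i, j) x)
      = (\<Sum>x\<in>V. \<Sum>k\<in>UNIV. edge_row e (\<lambda>x. q (x, k)) x * motion_row q (i, j) (x, k))"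
    by (simp add: sum.cartesian_product rigidity_row_def case_prod_beta)
  also have "\<dots> = (\<Sum>k\<in>UNIV. ?B k)" unfolding edge_form_def by (rule sum.swap)
  also have "\<dots> = 0"
  proof -
    obtain u v where uv: "e = {u, v}" "u \<noteq> v" "{u, v} \<subseteq> V" using assms by (elim simple_graph_edge)
    have fin: "finite V" using assms by (simp add: simple_graph_def)
    show ?thesis
    proof (cases "i = j")
      case True
      then show ?thesis unfolding uv(1) by (simp add: edge_form_pair[OF fin uv(3,2)] motion_row_def)
    next
      case False
      have "(\<Sum>k\<in>UNIV. ?B k) = (\<Sum>k\<in>{i, j}. ?B k)"
        by (rule sum.mono_neutral_right) (use False in \<open>auto simp: edge_form_def motion_row_def\<close>)
      then show ?thesis
        using False unfolding uv(1)
        by (simp add: edge_form_pair[OF fin uv(3,2)] motion_row_def algebra_simps)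
    qed
  qed
  finally show ?thesis .
qed

definition index_pairs :: "('k \<Rightarrow> nat) \<Rightarrow> ('k \<times> 'k) set" where
  "index_pairs r = {(i, j). r i \<le> r j}"

lemma card_index_pairs:
  assumes "bij_betw r (UNIV :: 'k::finite set) {..<CARD('k)}"
  shows "card (index_pairs r) = Suc CARD('k) choose 2"
proof -
  have inj: "inj (map_prod r r)"
    using assms by (auto simp: bij_betw_def intro: map_prod_inj_on[of _ UNIV _ UNIV, simplified])
  have "map_prod r r ` index_pairs r = (SIGMA b:{..<CARD('k)}. {..b})\<inverse>"
    using assms unfolding bij_betw_def index_pairs_def
    by (auto simp: image_iff set_eq_iff) (metis le_less_trans)+
  then have "card (index_pairs r) = card (SIGMA b:{..<CARD('k)}. {..b})"
    using card_image[OF inj_on_subset[OF inj subset_UNIV], of "index_pairs r"] by (simp add: card_inverse)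
  also have "\<dots> = (\<Sum>b<CARD('k). Suc b)" by simp
  also have "\<dots> = Suc CARD('k) choose 2"
  proof -
    have "(\<Sum>b<n. Suc b) = Suc n choose 2" for n
      by (induction n) (simp_all add: numeral_2_eq_2)
    then show ?thesis .
  qed
  finally show ?thesis .
qed

text \<open>Some vertices form a simplex: \<open>h None\<close> sits at the origin and
  \<open>h (Some k)\<close> at the unit vector of axis \<open>k\<close>. All remaining vertices are
  at the origin.\<close>

lemma motion_row_indep_exists:
  fixes r :: "'k::finite \<Rightarrow> nat"
  assumes "inj r" "finite V" "card V > CARD('k)"
  shows "\<exists>q. row_indep (index_pairs r) (V \<times> UNIV) (motion_row q)"
proof -
  have "card (UNIV :: 'k option set) \<le> card V" using assms(3) by (simp add: card_UNIV_option)
  then obtain h :: "'k option \<Rightarrow> 'a" where h: "inj h" "range h \<subseteq> V"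
    using card_le_inj[OF _ assms(2), of "UNIV :: 'k option set"] by auto
  define q where "q = (\<lambda>(x, k). if x = h (Some k) then 1 else 0 :: real)"
  have [simp]: "h a = h b \<longleftrightarrow> a = b" for a b using h(1) by (auto dest: injD)
  have hV: "h a \<in> V" for a using h(2) by auto
  have rinj: "r a = r b \<Longrightarrow> a = b" for a b using assms(1) by (auto dest: injD)
  have "row_indep (index_pairs r) (V \<times> UNIV) (motion_row q)"
    unfolding row_indep_def
  proof (intro allI impI ballI)
    fix c ij
    assume c: "\<forall>x\<in>V \<times> UNIV. (\<Sum>a\<in>index_pairs r. c a * motion_row q a x) = 0"
      and ij: "ij \<in> index_pairs r"
    obtain i j where [simp]: "ij = (i, j)" by (cases ij)
    \<comment> \<open>Rotations fix the origin, so the velocity there isolates the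
      translations.\<close>
    have diag: "c (k, k) = 0" for k
    proof -
      have "(\<Sum>a\<in>index_pairs r. c a * motion_row q a (h None, k))
          = (\<Sum>a\<in>index_pairs r. if a = (k, k) then c (k, k) else 0)"
        by (intro sum.cong refl) (auto simp: motion_row_def q_def split: if_splits)
      also have "\<dots> = c (k, k)" by (simp add: index_pairs_def)
      finally show ?thesis using c hV by auto
    qed
    show "c ij = 0"
    proof (cases "i = j")
      case True
      then show ?thesis using diag by simp
    next
      case False
      \<comment> \<open>At the unit vector of axis \<open>j\<close>, only rotations in the plane of
        \<open>i\<close> and \<open>j\<close> and the translation along \<open>i\<close> have a
        component along \<open>i\<close>. The numbering excludes \<open>(j, i)\<close>, and
        \<open>diag\<close> removes the translation.\<close>
      have "(\<Sum>a\<in>index_pairs r. c a * motion_row q a (h (Some j), i))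
          = (\<Sum>a\<in>index_pairs r. if a = (i, j) then c (i, j) else 0)"
      proof (intro sum.cong refl)
        fix a assume "a \<in> index_pairs r"
        then show "c a * motion_row q a (h (Some j), i) = (if a = (i, j) then c (i, j) else 0)"
          using ij False rinj[of i j] diag by (cases a) (auto simp: motion_row_def q_def index_pairs_def)
      qed
      also have "\<dots> = c (i, j)" using ij by simp
      finally show ?thesis using c hV by auto
    qed
  qed
  then show ?thesis by blast
qed

section \<open>Linked pairs in one dimension higher\<close>

definition lift :: "('v \<times> 'd \<Rightarrow> real) \<Rightarrow> ('v \<Rightarrow> real) \<Rightarrow> 'v \<times> 'd option \<Rightarrow> real" where
  "lift p h = (\<lambda>(x, k). case k of None \<Rightarrow> h x | Some i \<Rightarrow> p (x, i))"

lemma lift_simps [simp]: "lift p h (x, None) = h x" "lift p h (x, Some i) = p (x, i)"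
  by (simp_all add: lift_def)

lemma lift_project: "lift (\<lambda>(x, i). q (x, Some i)) (\<lambda>x. q (x, None)) = q"
  by (auto simp: lift_def split: option.split)

text \<open>Rational heights are substituted as constants, so the coefficients remain
  rational.\<close>

lemma rat_poly_fun_lift:
  assumes "f \<in> rat_poly_fun (V \<times> UNIV)" "\<And>x. x \<in> V \<Longrightarrow> h x \<in> \<rat>"
  shows "(\<lambda>p. f (lift p h)) \<in> rat_poly_fun (V \<times> UNIV)"
  using assms(1)
proof induction
  case (var j)
  then obtain x k where "j = (x, k)" "x \<in> V" by auto
  then show ?case using assms(2) by (cases k) (auto intro: rat_poly_fun.intros)
qed (auto intro: rat_poly_fun.intros)

text \<open>With the heights of \<open>q\<close> fixed, \<open>g\<close> is a rational polynomial in
  the other coordinates, nonzero at those of \<open>q\<close> and therefore at the generic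
  \<open>p\<close>.\<close>

lemma alg_independent_lift_nonzero:
  assumes "alg_independent_over_rat (V \<times> UNIV) p" "g \<in> rat_poly_fun (V \<times> UNIV)" "g q \<noteq> 0"
    and "\<And>x. x \<in> V \<Longrightarrow> q (x, None) \<in> \<rat>"
  shows "g (lift p (\<lambda>x. q (x, None))) \<noteq> 0"
proof
  assume "g (lift p (\<lambda>x. q (x, None))) = 0"
  then have "g (lift (\<lambda>(x, i). q (x, Some i)) (\<lambda>x. q (x, None))) = 0"
    by (rule alg_independent_vanish[OF assms(1) rat_poly_fun_lift[OF assms(2)], rotated])
      (use assms(4) in auto)
  then show False using assms(3) by (simp only: lift_project)
qed

text \<open>Let \<open>\<sigma>\<close> be one of the stresses of \<open>(p, h)\<close> with \<open>\<sigma> e = 1\<close>. Any other, \<open>\<omega>\<close>, differs from it by a stress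
  of \<open>p\<close> that avoids \<open>e\<close> and hence is a stress of \<open>p'\<close>. So the stress matrices of \<open>\<sigma>\<close> and \<open>\<omega>\<close>
  agree on \<open>p'\<close>; as the latter kills its own height function \<open>h\<close>, varying \<open>h\<close> shows that
  \<open>\<sigma>\<close> is a stress of \<open>p'\<close>.\<close>
lemma edge_length_determined:
  fixes p p' :: "'v \<times> 'd::finite \<Rightarrow> real"
  assumes graph: "simple_graph V E" and e: "{a, b} \<in> E"
    and generic: "alg_independent_over_rat (V \<times> UNIV) p"
    and equiv: "\<And>u v. {u, v} \<in> E - {{a, b}} \<Longrightarrow>
      (\<Sum>k\<in>UNIV. (p (u, k) - p (v, k))\<^sup>2) = (\<Sum>k\<in>UNIV. (p' (u, k) - p' (v, k))\<^sup>2)"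
    and heights: "h0 \<in> S" "\<And>x. x \<in> V \<Longrightarrow> \<exists>s. s \<noteq> h0 x \<and> h0(x := s) \<in> S"
    and stress: "\<And>h. h \<in> S \<Longrightarrow>
      \<exists>w. w {a, b} = 1 \<and> (\<forall>k. is_stress V E w (\<lambda>x. lift p h (x, k)))"
  shows "(\<Sum>k\<in>UNIV. (p (a, k) - p (b, k))\<^sup>2) = (\<Sum>k\<in>UNIV. (p' (a, k) - p' (b, k))\<^sup>2)"
proof -
  define H where "H = E - {{a, b}}"
  have finV: "finite V" using graph by (simp add: simple_graph_def)
  have finE: "finite E"
    using graph by (auto simp: simple_graph_def intro: finite_subset[of E "Pow V"])
  have graphH: "simple_graph V H" using graph by (simp add: simple_graph_def H_def)
  have equivH: "\<And>u v. {u, v} \<in> H \<Longrightarrow>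
      (\<Sum>k\<in>UNIV. (p (u, k) - p (v, k))\<^sup>2) = (\<Sum>k\<in>UNIV. (p' (u, k) - p' (v, k))\<^sup>2)"
    using equiv by (simp add: H_def)
  obtain w where w: "\<And>h. h \<in> S \<Longrightarrow> w h {a, b} = 1"
      "\<And>h k. h \<in> S \<Longrightarrow> is_stress V E (w h) (\<lambda>x. lift p h (x, k))"
    using stress by metis
  have w_h: "is_stress V E (w h) h" and w_p: "is_stress V E (w h) (\<lambda>x. p (x, k))" if "h \<in> S" for h k
    using w(2)[OF that, of None] w(2)[OF that, of "Some k"] by simp_all
  define s where "s = w h0"
  have diff: "is_stress V E (\<lambda>f. w h f - s f) (\<lambda>x. p' (x, k))" if "h \<in> S" for h k
  proof -
    \<comment> \<open>Both stresses are \<open>1\<close> on \<open>{a, b}\<close>, so their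
      difference lives on \<open>H\<close>, where stresses transfer from \<open>p\<close> to
      \<open>p'\<close>.\<close>
    have restrict: "is_stress V E (\<lambda>f. w h f - s f) f \<longleftrightarrow> is_stress V H (\<lambda>f. w h f - s f) f" for f
      by (rule is_stress_restrict[OF finE]) (use that w(1) heights(1) in \<open>auto simp: H_def s_def\<close>)
    have "is_stress V E (\<lambda>f. w h f - s f) (\<lambda>x. p (x, k))" for k
      unfolding s_def by (intro is_stress_diff w_p that heights(1))
    then have "is_stress V H (\<lambda>f. w h f - s f) (\<lambda>x. p (x, k))" for k
      unfolding restrict .
    from stress_transfer[OF graphH generic equivH this] show ?thesis unfolding restrict by blast
  qed
  \<comment> \<open>\<open>Q h k\<close> pairs \<open>h\<close> with the image of axis
    \<open>k\<close> of \<open>p'\<close> under the stress matrix of \<open>s\<close>. By symmetry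
    of the form, \<open>w h\<close> can act on its own height function \<open>h\<close>.\<close>
  define Q where "Q h k = (\<Sum>f\<in>E. s f * edge_form V f (\<lambda>x. p' (x, k)) h)" for h k
  have Q0: "Q h k = 0" if "h \<in> S" for h k
  proof -
    have "Q h k = (\<Sum>f\<in>E. w h f * edge_form V f (\<lambda>x. p' (x, k)) h)
        - (\<Sum>f\<in>E. (w h f - s f) * edge_form V f (\<lambda>x. p' (x, k)) h)"
      by (simp add: Q_def left_diff_distrib sum_subtractf)
    also have "(\<Sum>f\<in>E. w h f * edge_form V f (\<lambda>x. p' (x, k)) h)
        = (\<Sum>f\<in>E. w h f * edge_form V f h (\<lambda>x. p' (x, k)))"
      by (intro sum.cong refl) (simp add: edge_form_commute[OF graph])
    finally show ?thesis
      using is_stress_form[OF w_h[OF that]] is_stress_form[OF diff[OF that]] by simp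
  qed
  have Q_row: "Q h k = (\<Sum>x\<in>V. (\<Sum>f\<in>E. s f * edge_row f (\<lambda>x. p' (x, k)) x) * h x)" for h k
    unfolding Q_def edge_form_def sum_distrib_left sum_distrib_right
    by (subst sum.swap) (simp add: mult_ac)
  have s_p': "is_stress V E s (\<lambda>x. p' (x, k))" for k
    unfolding is_stress_def
  proof
    fix x assume x: "x \<in> V"
    let ?r = "\<lambda>x. \<Sum>f\<in>E. s f * edge_row f (\<lambda>x. p' (x, k)) x"
    obtain t where t: "t \<noteq> h0 x" "h0(x := t) \<in> S" using heights(2)[OF x] by blast
    \<comment> \<open>\<open>Q\<close> is linear in the heights, so changing one height isolates the
      equilibrium defect at that vertex.\<close>
    have "Q (h0(x := t)) k - Q h0 k = (\<Sum>y\<in>V. ?r y * (if y = x then t - h0 x else 0))"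
      unfolding Q_row sum_subtractf[symmetric] by (intro sum.cong refl) (simp add: algebra_simps)
    also have "\<dots> = ?r x * (t - h0 x)"
      using finV x by (simp add: if_distrib[of "\<lambda>t. _ * t"] cong: if_cong)
    finally show "?r x = 0" using Q0[OF t(2)] Q0[OF heights(1)] t(1) by simp
  qed
  define L where "L q f = (\<Sum>k\<in>UNIV. edge_form V f (\<lambda>x. q (x, k)) (\<lambda>x. q (x, k)))"
    for q :: "'v \<times> 'd \<Rightarrow> real" and f
  have L: "L q {u, v} = (\<Sum>k\<in>UNIV. (q (u, k) - q (v, k))\<^sup>2)" if uv: "{u, v} \<in> E" for q u v
  proof -
    from graph uv have "{u, v} \<subseteq> V" "card {u, v} = 2" by (auto simp: simple_graph_def)
    then show ?thesis
      by (auto simp: L_def edge_form_pair[OF finV] power2_eq_square card_insert_if split: if_splits)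
  qed
  have energy: "(\<Sum>f\<in>E. s f * L q f) = 0" if "\<And>k. is_stress V E s (\<lambda>x. q (x, k))" for q
  proof -
    have "(\<Sum>f\<in>E. s f * L q f)
        = (\<Sum>k\<in>UNIV. \<Sum>f\<in>E. s f * edge_form V f (\<lambda>x. q (x, k)) (\<lambda>x. q (x, k)))"
      unfolding L_def sum_distrib_left by (rule sum.swap)
    then show ?thesis using is_stress_form[OF that] by simp
  qed
  have "L p f = L p' f" if "f \<in> H" for f
  proof -
    obtain u v where "f = {u, v}" using simple_graph_edge[OF graphH \<open>f \<in> H\<close>] by metis
    then show ?thesis using that equivH[of u v] L[of u v] by (simp add: H_def)
  qed
  then have "(\<Sum>f\<in>H. s f * L p f) = (\<Sum>f\<in>H. s f * L p' f)" by simp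
  moreover have "(\<Sum>f\<in>E. s f * L p f) = (\<Sum>f\<in>E. s f * L p' f)"
    using energy[of p] energy[of p'] s_p' w_p[OF heights(1)] by (simp add: s_def)
  \<comment> \<open>Both energies vanish and agree on \<open>H\<close>; the remaining term has
    coefficient \<open>1\<close>.\<close>
  ultimately have "L p {a, b} = L p' {a, b}"
    using w(1)[OF heights(1)] e finE by (simp add: H_def sum.remove[OF finE e] s_def)
  then show ?thesis using L[OF e] by simp
qed

text \<open>Rigidity rows are orthogonal to the infinitesimal isometries, so independent rows number
  at most \<open>CARD('k) * card V\<close> minus the number of motions. A largest attainable
  \<open>F\<close> thus misses an edge \<open>e\<close>.\<close>

lemma exists_dependent_edge:
  fixes V :: "'v set" and E :: "'v set set"
  assumes graph: "simple_graph V E" and card: "CARD('k::finite) < card V"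
    and large: "CARD('k) * card V < card E + (Suc CARD('k) choose 2)"
  obtains e F and g :: "('v \<times> 'k::finite \<Rightarrow> real) \<Rightarrow> real" and q0
  where "e \<in> E" "e \<notin> F" "insert e F \<subseteq> E" "g \<in> rat_poly_fun (V \<times> UNIV)" "g q0 \<noteq> 0"
    "\<And>q. g q \<noteq> 0 \<Longrightarrow> row_indep F (V \<times> UNIV) (rigidity_row q)
      \<and> \<not> row_indep (insert e F) (V \<times> UNIV) (rigidity_row q)"
proof -
  have finV: "finite V" using graph by (simp add: simple_graph_def)
  have finE: "finite E"
    using graph by (auto simp: simple_graph_def intro: finite_subset[of E "Pow V"])
  let ?I = "V \<times> (UNIV :: 'k set)"
  obtain r :: "'k \<Rightarrow> nat" where r: "bij_betw r UNIV {..<CARD('k)}"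
    using ex_bij_betw_finite_nat[of "UNIV :: 'k set"] by (auto simp: atLeast0LessThan)
  define T where "T = index_pairs r"
  have finT: "finite T" by simp
  have cardT: "card T = Suc CARD('k) choose 2" unfolding T_def by (rule card_index_pairs[OF r])
  \<comment> \<open>Independent motions are demanded at the same \<open>q\<close>, so that the bound
    applies to \<open>F\<close>.\<close>
  define ok where "ok F \<longleftrightarrow> F \<subseteq> E \<and> (\<exists>q :: 'v \<times> 'k \<Rightarrow> real.
      row_indep F ?I (rigidity_row q) \<and> row_indep T ?I (motion_row q))" for F
  have bound: "card F + card T \<le> CARD('k) * card V" if "ok F" for F
  proof -
    from that obtain q :: "'v \<times> 'k \<Rightarrow> real" where F: "F \<subseteq> E"
      "row_indep F ?I (rigidity_row q)" "row_indep T ?I (motion_row q)" by (auto simp: ok_def)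
    have "card F + card T \<le> card ?I"
    proof (rule row_indep_orthogonal[OF _ finT _ _ F(2,3)])
      show "finite F" using F(1) finE by (rule finite_subset)
      show "finite ?I" using finV by simp
      show "(\<Sum>x\<in>?I. rigidity_row q e x * motion_row q ij x) = 0" if "e \<in> F" for e ij
        using rigidity_row_motion_row_orthogonal[OF graph, of e q] that F(1) by (cases ij) auto
    qed
    then show ?thesis by (simp add: card_cartesian_product mult.commute)
  qed
  have "inj r" using r by (simp add: bij_betw_def)
  from motion_row_indep_exists[OF this finV card] have "ok {}"
    by (simp add: ok_def T_def row_indep_def[of "{}"])
  moreover have "card F < Suc (CARD('k) * card V)" if "ok F" for F using bound[OF that] by simp
  ultimately obtain F where F: "ok F" and max: "\<And>F'. ok F' \<Longrightarrow> card F' \<le> card F"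
    using ex_has_greatest_nat[of ok "{}" card "Suc (CARD('k) * card V)"]
    by (metis less_imp_le_nat)
  have FE: "F \<subseteq> E" using F by (simp add: ok_def)
  have finF: "finite F" using FE finE by (rule finite_subset)
  have "F \<noteq> E" using bound[OF F] large cardT by auto
  then obtain e where e: "e \<in> E" "e \<notin> F" using FE by blast
  have no: "\<not> ok (insert e F)" using max[of "insert e F"] e finF by auto
  obtain q0 :: "'v \<times> 'k \<Rightarrow> real" where q0: "row_indep F ?I (rigidity_row q0)"
      "row_indep T ?I (motion_row q0)"
    using F by (auto simp: ok_def)
  have poly: "(\<lambda>q. rigidity_row q a i) \<in> rat_poly_fun ?I" if "a \<in> F" "i \<in> ?I" for a and i :: "'v \<times> 'k"
    using that FE graph finite_subset[OF _ finV]
    by (intro rigidity_row_rat_poly_fun) (auto simp: simple_graph_def)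
  obtain g1 where g1: "g1 \<in> rat_poly_fun ?I" "g1 q0 \<noteq> 0"
      "\<And>q. g1 q \<noteq> 0 \<Longrightarrow> row_indep F ?I (rigidity_row q)"
    using row_indep_certificate[of F ?I "\<lambda>a i q. rigidity_row q a i" q0, OF finF _ poly] q0(1) by auto
  obtain g2 where g2: "g2 \<in> rat_poly_fun ?I" "g2 q0 \<noteq> 0"
      "\<And>q. g2 q \<noteq> 0 \<Longrightarrow> row_indep T ?I (motion_row q)"
    using row_indep_certificate[of T ?I "\<lambda>a i q. motion_row q a i" q0, OF finT _ motion_row_rat_poly_fun]
      q0(2) by auto
  show ?thesis
  proof (rule that[of e F "\<lambda>q. g1 q * g2 q" q0])
    show "(\<lambda>q. g1 q * g2 q) \<in> rat_poly_fun ?I" using g1(1) g2(1) by (rule rat_poly_fun.mult)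
    \<comment> \<open>Here \<open>g2\<close> provides independent motions at \<open>q\<close>, so
      independence of \<open>insert e F\<close> would make it \<open>ok\<close>, against maximality
      of \<open>F\<close>.\<close>
    fix q :: "'v \<times> 'k \<Rightarrow> real" assume "g1 q * g2 q \<noteq> 0"
    then show "row_indep F ?I (rigidity_row q) \<and> \<not> row_indep (insert e F) ?I (rigidity_row q)"
      using g1(3)[of q] g2(3)[of q] no e FE by (auto simp: ok_def)
  qed (use e FE g1 g2 in auto)
qed

section \<open>The edge bound for minimally globally rigid graphs\<close>

theorem theorem3p3:
  fixes V :: "'v set" and E :: "'v set set"
  assumes "simple_graph V E"
    and "card V \<ge> CARD('d::finite) + 2"
    and "minimally_globally_rigid TYPE('d) V E"
  shows "int (card E) \<le> (int CARD('d) + 1) * int (card V) - int ((CARD('d) + 2) choose 2)"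
proof (rule ccontr)
  assume "\<not> ?thesis"
  \<comment> \<open>\<open>'d option\<close> stands for dimension \<open>d + 1\<close>; the binomial
    coefficient counts the independent infinitesimal isometries there.\<close>
  then have "int (CARD('d option) * card V) < int (card E + (Suc CARD('d option) choose 2))"
    by (simp add: card_UNIV_option algebra_simps)
  then have large: "CARD('d option) * card V < card E + (Suc CARD('d option) choose 2)"
    by linarith
  have "CARD('d option) < card V" using assms(2) by (simp add: card_UNIV_option)
  from exists_dependent_edge[OF assms(1) this large]
  obtain e F and g :: "('v \<times> 'd option \<Rightarrow> real) \<Rightarrow> real" and q0
    where e: "e \<in> E" "e \<notin> F" "insert e F \<subseteq> E" and g: "g \<in> rat_poly_fun (V \<times> UNIV)" "g q0 \<noteq> 0"
      and dep: "\<And>q. g q \<noteq> 0 \<Longrightarrow> row_indep F (V \<times> UNIV) (rigidity_row q)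
        \<and> \<not> row_indep (insert e F) (V \<times> UNIV) (rigidity_row q)"
    by blast
  have finV: "finite V" using assms(1) by (simp add: simple_graph_def)
  have finE: "finite E"
    using assms(1) by (auto simp: simple_graph_def intro: finite_subset[of E "Pow V"])
  from e(1) assms(3) have "\<not> globally_rigid TYPE('d) V (E - {e})"
    by (simp add: minimally_globally_rigid_def)
  then obtain p p' :: "'v \<Rightarrow> real ^ 'd" where generic: "generic_realization V p"
      and eq: "equivalent_frameworks (E - {e}) p p'" and not_cong: "\<not> congruent_frameworks V p p'"
    unfolding globally_rigid_def globally_rigid_framework_def by blast
  \<comment> \<open>Global rigidity of \<open>E\<close> forces \<open>p\<close> and
    \<open>p'\<close> to differ in the length of some edge, which can only be
    \<open>e\<close>.\<close>
  have "\<not> equivalent_frameworks E p p'"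
    using assms(3) generic not_cong
    unfolding minimally_globally_rigid_def globally_rigid_def globally_rigid_framework_def by blast
  then obtain a b where ab: "{a, b} \<in> E" "norm (p a - p b) \<noteq> norm (p' a - p' b)"
    by (auto simp: equivalent_frameworks_def)
  then have e_ab: "e = {a, b}" using eq by (auto simp: equivalent_frameworks_def)
  define P where "P = (\<lambda>(x, k). p x $ k)"
  define P' where "P' = (\<lambda>(x, k). p' x $ k)"
  have gen: "alg_independent_over_rat (V \<times> UNIV) P"
    using generic by (simp add: generic_realization_def P_def)
  have norm_sq: "(norm (p u - p v))\<^sup>2 = (\<Sum>k\<in>UNIV. (P (u, k) - P (v, k))\<^sup>2)"
    "(norm (p' u - p' v))\<^sup>2 = (\<Sum>k\<in>UNIV. (P' (u, k) - P' (v, k))\<^sup>2)" for u v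
    by (simp_all add: norm_vec_def L2_set_def sum_nonneg P_def P'_def)
  \<comment> \<open>Only \<open>p\<close> is known to be generic, so the heights are taken rational;
    \<open>g\<close> then stays nonzero after \<open>p\<close> is substituted.\<close>
  obtain z where z: "g z \<noteq> 0" "\<forall>i\<in>V \<times> {None}. z i \<in> \<rat>"
    using rat_poly_fun_rational_point[OF g(1) _ g(2), of "V \<times> {None}"] finV by auto
  define S where "S = {h. g (lift P h) \<noteq> 0}"
  have "(\<Sum>k\<in>UNIV. (P (a, k) - P (b, k))\<^sup>2) = (\<Sum>k\<in>UNIV. (P' (a, k) - P' (b, k))\<^sup>2)"
  proof (rule edge_length_determined[OF assms(1) ab(1) gen, of P' "\<lambda>x. z (x, None)" S])
    show "(\<Sum>k\<in>UNIV. (P (u, k) - P (v, k))\<^sup>2) = (\<Sum>k\<in>UNIV. (P' (u, k) - P' (v, k))\<^sup>2)"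
      if "{u, v} \<in> E - {{a, b}}" for u v
      using eq that by (simp add: equivalent_frameworks_def e_ab flip: norm_sq)
    show "(\<lambda>x. z (x, None)) \<in> S"
      using alg_independent_lift_nonzero[OF gen g(1) z(1)] z(2) by (simp add: S_def)
    show "\<exists>s. s \<noteq> z (x, None) \<and> (\<lambda>x. z (x, None))(x := s) \<in> S" if "x \<in> V" for x
    proof -
      obtain s where s: "s \<in> \<rat>" "s \<noteq> z (x, None)" "g (z((x, None) := s)) \<noteq> 0"
        using rat_poly_fun_rational_update[OF g(1) z(1)] by blast
      have "g (lift P (\<lambda>y. (z((x, None) := s)) (y, None))) \<noteq> 0"
        by (rule alg_independent_lift_nonzero[OF gen g(1) s(3)]) (use z(2) s(1) in auto)
      moreover have "(\<lambda>y. (z((x, None) := s)) (y, None)) = (\<lambda>x. z (x, None))(x := s)" by auto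
      ultimately show ?thesis using s(2) by (auto simp: S_def simp del: fun_upd_apply)
    qed
    show "\<exists>w. w {a, b} = 1 \<and> (\<forall>k. is_stress V E w (\<lambda>x. lift P h (x, k)))" if "h \<in> S" for h
    proof -
      have "g (lift P h) \<noteq> 0" using that by (simp add: S_def)
      from dep[OF this] obtain w where "w e = 1" "\<And>k. is_stress V E w (\<lambda>x. lift P h (x, k))"
        using stress_of_dependent_edge[OF finE e(3,2)] by metis
      then show ?thesis using e_ab by blast
    qed
  qed
  then have "(norm (p a - p b))\<^sup>2 = (norm (p' a - p' b))\<^sup>2" unfolding norm_sq .
  then show False using ab(2) by simp
qed

end
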